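(* Let $n$ be a positive integer, let $k\geq 2$ be an integer, and let $f,g:V(C_n)\to\{1,\ldots,k\}$ be $k$-color weak maximizers of $W$ on $C_n$ with $\mathrm{type}(g)\prec\mathrm{type}(f)$. Then $W(g)\leq W(f)$.
   Context: $C_n$ is the cycle on $n$ vertices (vertices $0,\ldots,n-1$, with distinct vertices $i,j$ adjacent iff $i-j\equiv\pm1\pmod n$). For a finite simple connected graph $G$ and $A\subseteq V(G)$, $W(A)=\sum_{\{u,v\}\in\binom{A}{2}}d_G(u,v)$, with $d_G$ the shortest-path distance. A $k$-coloring of $G$ is any function $f:V(G)\to\{1,\ldots,k\}$; $\mathrm{type}(f)$ is the $k$-tuple of the cardinalities $|f^{-1}(1)|,\ldots,|f^{-1}(k)|$ arranged in non-decreasing order, and $W(f)=\sum_{i=1}^k W(f^{-1}(i))$. For $k\geq 2$, $f$ is a $k$-color weak maximizer of $W$ on $G$ if $f$ is surjective and $W(f)\geq W(f')$ for all surjective $f':V(G)\to\{1,\ldots,k\}$ with $\mathrm{type}(f')=\mathrm{type}(f)$. Majorization: for $x\in\mathbb{R}^k$ let $x_{[1]}\geq\cdots\geq x_{[k]}$ be its components in non-increasing order. For $x,y\in\mathbb{R}^k$, $x\prec y$ means $\sum_{j=1}^s x_{[j]}\leq\sum_{j=1}^s y_{[j]}$ for $s=1,\ldots,k-1$ and $\sum_{j=1}^k x_{[j]}=\sum_{j=1}^k y_{[j]}$. *)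

theory Defs
  imports
    "Graph_Theory.Graph_Theory"
    "HOL-Library.Ramsey"
    "HOL-Number_Theory.Cong"
begin

section \<open>Distance and Wiener index\<close>

text \<open>Undirected graphs are symmetric digraphs (locale \<^locale>\<open>graph\<close>). Giving every arc
  weight 1 turns the weighted shortest-path length, an extended real, into the usual distance;
  it is finite whenever the two vertices are connected.\<close>

definition graph_dist :: "('a, 'b) pre_digraph \<Rightarrow> 'a \<Rightarrow> 'a \<Rightarrow> real" where
  "graph_dist G u v = real_of_ereal (wf_digraph.\<mu> G (\<lambda>_. 1) u v)"

text \<open>The distance as a function of an unordered pair; see \<open>pair_dist_doubleton\<close> below.\<close>

definition pair_dist :: "('a, 'b) pre_digraph \<Rightarrow> 'a set \<Rightarrow> real" where
  "pair_dist G e = (THE d. \<exists>u v. e = {u, v} \<and> d = graph_dist G u v)"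

definition wiener :: "('a, 'b) pre_digraph \<Rightarrow> 'a set \<Rightarrow> real" where
  "wiener G A = (\<Sum>e\<in>nsets A 2. pair_dist G e)"

lemma (in sym_digraph) awalk_reverse:
  assumes "awalk u p v"
  shows "\<exists>q. awalk v q u \<and> length q = length p"
  using assms
proof (induction p arbitrary: u)
  case Nil
  then show ?case
    by (intro exI[of _ "[]"]) (auto simp: awalk_def)
next
  case (Cons e p)
  then have e: "e \<in> arcs G" "tail G e = u" and p: "awalk (head G e) p v"
    by (auto simp: awalk_Cons_iff)
  obtain q where q: "awalk v q (head G e)" "length q = length p"
    using Cons.IH[OF p] by blast
  obtain e' where e': "e' \<in> arcs G" "tail G e' = head G e" "head G e' = tail G e"
    using sym_arcs e by (metis symmetric_conv)
  have "awalk (head G e) [e'] u"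
    using e e' by (auto simp: awalk_Cons_iff awalk_Nil_iff)
  then have "awalk v (q @ [e']) u"
    using q by auto
  then show ?case
    using q by (intro exI[of _ "q @ [e']"]) auto
qed

lemma (in wf_digraph) awalk_cost_unit: "awalk_cost (\<lambda>_. 1) p = real (length p)"
  by (induction p) auto

lemma (in sym_digraph) graph_dist_commute: "graph_dist G u v = graph_dist G v u"
proof -
  have "(\<lambda>p. ereal (awalk_cost (\<lambda>_. 1) p)) ` {p. awalk u p v} \<subseteq>
        (\<lambda>p. ereal (awalk_cost (\<lambda>_. 1) p)) ` {p. awalk v p u}" for u v
  proof clarify
    fix p assume "awalk u p v"
    then obtain q where q: "awalk v q u" "length q = length p"
      using awalk_reverse by blast
    then have "ereal (awalk_cost (\<lambda>_. 1) p) = ereal (awalk_cost (\<lambda>_. 1) q)"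
      by (simp add: awalk_cost_unit)
    then show "ereal (awalk_cost (\<lambda>_. 1) p) \<in>
        (\<lambda>p. ereal (awalk_cost (\<lambda>_. 1) p)) ` {p. awalk v p u}"
      using q by blast
  qed
  then have "(\<lambda>p. ereal (awalk_cost (\<lambda>_. 1) p)) ` {p. awalk u p v} =
        (\<lambda>p. ereal (awalk_cost (\<lambda>_. 1) p)) ` {p. awalk v p u}"
    by blast
  then show ?thesis
    unfolding graph_dist_def \<mu>_def by simp
qed

lemma (in sym_digraph) pair_dist_doubleton: "pair_dist G {u, v} = graph_dist G u v"
  unfolding pair_dist_def
  by (rule the_equality) (auto simp: doubleton_eq_iff graph_dist_commute)

section \<open>Colorings\<close>

text \<open>A coloring is a total function on the vertex type; only its values on \<open>verts G\<close> matter.\<close>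

definition color_class :: "('a, 'b) pre_digraph \<Rightarrow> ('a \<Rightarrow> nat) \<Rightarrow> nat \<Rightarrow> 'a set" where
  "color_class G f i = {v \<in> verts G. f v = i}"

definition coloring_type :: "('a, 'b) pre_digraph \<Rightarrow> nat \<Rightarrow> ('a \<Rightarrow> nat) \<Rightarrow> nat list" where
  "coloring_type G k f = sort (map (\<lambda>i. card (color_class G f i)) [1..<Suc k])"

definition coloring_wiener :: "('a, 'b) pre_digraph \<Rightarrow> nat \<Rightarrow> ('a \<Rightarrow> nat) \<Rightarrow> real" where
  "coloring_wiener G k f = (\<Sum>i=1..k. wiener G (color_class G f i))"

definition surj_coloring :: "('a, 'b) pre_digraph \<Rightarrow> nat \<Rightarrow> ('a \<Rightarrow> nat) \<Rightarrow> bool" where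
  "surj_coloring G k f \<longleftrightarrow> f ` verts G = {1..k}"

definition weak_maximizer :: "('a, 'b) pre_digraph \<Rightarrow> nat \<Rightarrow> ('a \<Rightarrow> nat) \<Rightarrow> bool" where
  "weak_maximizer G k f \<longleftrightarrow> surj_coloring G k f \<and>
     (\<forall>f'. surj_coloring G k f' \<and> coloring_type G k f' = coloring_type G k f \<longrightarrow>
        coloring_wiener G k f' \<le> coloring_wiener G k f)"

section \<open>Majorization\<close>

text \<open>\<open>majorized x y\<close> stands for $x \prec y$; vectors in $\mathbb{R}^k$ are lists of length $k$.\<close>

definition majorized :: "real list \<Rightarrow> real list \<Rightarrow> bool" where
  "majorized x y \<longleftrightarrow> length x = length y \<and>
     (\<forall>s\<in>{1..<length x}. sum_list (take s (rev (sort x))) \<le> sum_list (take s (rev (sort y)))) \<and>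
     sum_list (rev (sort x)) = sum_list (rev (sort y))"

section \<open>Cycles\<close>

text \<open>The requirement \<open>i \<noteq> j\<close> excludes the loop that the congruence alone would give for
  \<open>n = 1\<close>.\<close>

definition cycle_graph :: "nat \<Rightarrow> (nat, nat \<times> nat) pre_digraph" where
  "cycle_graph n = with_proj \<lparr> pverts = {..<n},
     parcs = {(i, j). i < n \<and> j < n \<and> i \<noteq> j \<and>
       ([int i - int j = 1] (mod int n) \<or> [int i - int j = -1] (mod int n))} \<rparr>"

lemma graph_cycle_graph: "graph (cycle_graph n)"
proof -
  let ?E = "{(i, j). i < n \<and> j < n \<and> i \<noteq> j \<and>
       ([int i - int j = 1] (mod int n) \<or> [int i - int j = -1] (mod int n))}"
  have "?E \<subseteq> {..<n} \<times> {..<n}" by auto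
  then have fin: "finite ?E"
    by (rule finite_subset) simp
  have neg: "[int j - int i = - c] (mod int n)" if "[int i - int j = c] (mod int n)" for i j c
    using cong_minus_minus_iff[of "int i - int j" c "int n"] that by simp
  have "sym ?E"
    using neg by (fastforce intro!: symI)
  then show ?thesis
    unfolding cycle_graph_def
    by unfold_locales (use fin in \<open>auto simp: symmetric_def arc_to_ends_def\<close>)
qed

lemma strongly_connected_cycle_graph:
  assumes "n \<ge> 1"
  shows "strongly_connected (cycle_graph n)"
proof -
  interpret graph "cycle_graph n" by (rule graph_cycle_graph)
  have r0: "0 \<rightarrow>\<^sup>*\<^bsub>cycle_graph n\<^esub> i" if "i < n" for i
    using that
  proof (induction i)
    case 0
    then show ?case by (intro reachable_refl) (simp add: cycle_graph_def)
  next
    case (Suc i)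
    then have "i \<rightarrow>\<^bsub>cycle_graph n\<^esub> Suc i"
      by (simp add: cycle_graph_def)
    with Suc show ?case
      by (meson Suc_lessD reachable_adj_trans)
  qed
  have "u \<rightarrow>\<^sup>*\<^bsub>cycle_graph n\<^esub> v" if "u < n" "v < n" for u v
    using r0[OF that(1)] r0[OF that(2)] symmetric_reachable[OF sym_arcs]
      reachable_trans by blast
  then show ?thesis
    using assms by (intro strongly_connectedI) (auto simp: cycle_graph_def lessThan_empty_iff)
qed

end

theory Submission
  imports Defs
begin

text \<open>The Wiener index of a weak maximizer on a cycle depends only on its type, through a convex
  function of the class sizes, and the theorem is then Karamata's inequality.

  Let $F(m)$ be the largest Wiener index of a set of $m$ vertices of the $n$-cycle
  (\<open>max_wiener\<close>). The bound $W(A) \le F(|A|)$ is proved in \<open>wiener_cycle_graph_le\<close> by removing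
  two vertices that halve the rest of $A$: every other vertex is on one of the two arcs between
  them, and its two distances add up to at most the length of that arc.

  For prescribed class sizes with sum $n$ the bound is attained by all classes at once. Enumerate
  the vertices by jumping between opposite sides of the cycle (\<open>zigzag\<close>). A block of
  consecutive vertices in this order has the largest possible Wiener index for its size,
  except if $n$ and the size of the block are even and the block starts at an odd position
  (\<open>wiener_zigzag_block\<close>). Cutting the enumeration into blocks with the even sizes first avoids
  the exception (\<open>exists_parity_tiling\<close>). So a weak maximizer with class sizes
  $m_1, \ldots, m_k$ has Wiener index $F(m_1) + \cdots + F(m_k)$
  (\<open>coloring_wiener_weak_maximizer\<close>).

  The increments of $F$ (\<open>gain\<close>) increase on $\{0,\ldots,n\}$ (\<open>mono_on_gain\<close>), so $F$ is
  convex there, and the sum of its values respects majorization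
  (\<open>sum_list_le_if_majorized\<close>).\<close>

section \<open>Distance in a cycle\<close>

text \<open>The distance on the \<open>n\<close>-cycle as the length of the shorter of the two arcs. With truncated
  subtraction, \<open>(u - v) + (v - u)\<close> is the absolute difference of \<open>u\<close> and \<open>v\<close>.\<close>

definition cyc_dist :: "nat \<Rightarrow> nat \<Rightarrow> nat \<Rightarrow> nat" where
  "cyc_dist n u v = min ((u - v) + (v - u)) (n - ((u - v) + (v - u)))"

lemma cyc_dist_self [simp]: "cyc_dist n u u = 0"
  by (simp add: cyc_dist_def)

lemma cyc_dist_commute: "cyc_dist n u v = cyc_dist n v u"
  by (simp add: cyc_dist_def add.commute)

lemma cyc_dist_ordered: "u \<le> v \<Longrightarrow> cyc_dist n u v = min (v - u) (n - (v - u))"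
  by (simp add: cyc_dist_def)

lemma verts_cycle_graph [simp]: "verts (cycle_graph n) = {..<n}"
  by (simp add: cycle_graph_def)

lemma arcs_cycle_graph_iff:
  "(i, j) \<in> arcs (cycle_graph n) \<longleftrightarrow>
     i < n \<and> j < n \<and> i \<noteq> j \<and> (j = i + 1 \<or> i = j + 1 \<or> (i = 0 \<and> j = n - 1) \<or> (j = 0 \<and> i = n - 1))"
proof -
  have step: "[int i - int j = 1] (mod int n) \<longleftrightarrow> i = j + 1 \<or> (i = 0 \<and> j = n - 1)"
    if "i < n" "j < n" "i \<noteq> j" for i j
  proof
    assume "[int i - int j = 1] (mod int n)"
    then obtain q where q: "int i - int j - 1 = int n * q"
      by (auto simp: cong_iff_dvd_diff elim: dvdE)
    have "int n * q < int n * 1" "int n * (-2) < int n * q"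
      using that unfolding q[symmetric] by auto
    then have "q < 1" "-2 < q"
      using that by (simp_all only: mult_less_cancel_left_pos)
    then have "q = 0 \<or> q = -1" by auto
    then show "i = j + 1 \<or> (i = 0 \<and> j = n - 1)"
      using q that by auto
  next
    assume "i = j + 1 \<or> (i = 0 \<and> j = n - 1)"
    then show "[int i - int j = 1] (mod int n)"
    proof
      assume "i = 0 \<and> j = n - 1"
      then have "int i - int j - 1 = - int n"
        using that by auto
      then show ?thesis
        by (simp add: cong_iff_dvd_diff)
    qed simp
  qed
  have "[int i - int j = - 1] (mod int n) \<longleftrightarrow> [int j - int i = 1] (mod int n)"
    using cong_minus_minus_iff[of "int j - int i" 1 "int n"] by simp
  then show ?thesis
    using step[of i j] step[of j i] by (auto simp: cycle_graph_def)
qed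

lemma ends_cycle_graph [simp]: "tail (cycle_graph n) = fst" "head (cycle_graph n) = snd"
  by (simp_all add: cycle_graph_def)

text \<open>Over the integers the distance is a combination of absolute values and minima without truncated
  subtraction, which puts the comparison of neighbouring vertices within reach of linear
  arithmetic.\<close>

lemma int_cyc_dist:
  assumes "u < n" "v < n"
  shows "int (cyc_dist n u v) =
    min (\<bar>int u - int v\<bar>) (int n - \<bar>int u - int v\<bar>)"
proof (cases "u \<le> v")
  case True
  then have "(u - v) + (v - u) = v - u" by simp
  then show ?thesis
    using True assms by (simp add: cyc_dist_def of_nat_min of_nat_diff)
next
  case False
  then have "(u - v) + (v - u) = u - v" by simp
  then show ?thesis
    using False assms by (simp add: cyc_dist_def of_nat_min of_nat_diff)
qed

text \<open>This gives the lower bound on the length of a walk: every arc of a walk towards \<open>w\<close> lowers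
  \<^const>\<open>cyc_dist\<close> by at most one.\<close>

lemma cyc_dist_step_le:
  assumes "(u, v) \<in> arcs (cycle_graph n)" "w < n"
  shows "cyc_dist n u w \<le> Suc (cyc_dist n v w)"
proof -
  have uv: "u < n" "v < n" and
    adj: "int v = int u + 1 \<or> int u = int v + 1 \<or> (int u = 0 \<and> int v = int n - 1)
      \<or> (int v = 0 \<and> int u = int n - 1)"
    using assms(1) unfolding arcs_cycle_graph_iff by auto
  have "int (cyc_dist n u w) \<le> int (cyc_dist n v w) + 1"
    using adj uv assms(2) unfolding int_cyc_dist[OF uv(1) assms(2)] int_cyc_dist[OF uv(2) assms(2)]
    by (smt (verit) of_nat_0_le_iff of_nat_less_iff)
  then show ?thesis by simp
qed

text \<open>This gives a walk that attains the lower bound: one of the two neighbours of \<open>u\<close>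
  lies on a shortest arc towards \<open>w\<close>.\<close>

lemma cyc_dist_step_closer:
  assumes "u < n" "w < n" "cyc_dist n u w = Suc d"
  shows "\<exists>v. (u, v) \<in> arcs (cycle_graph n) \<and> cyc_dist n v w = d"
proof -
  define up where "up = (if u = n - 1 then 0 else u + 1)"
  define down where "down = (if u = 0 then n - 1 else u - 1)"
  have "u \<noteq> w" using assms(3) by auto
  then have n: "n \<ge> 2" using assms by linarith
  have arcs: "(u, up) \<in> arcs (cycle_graph n)" "(u, down) \<in> arcs (cycle_graph n)"
    using assms(1) n unfolding arcs_cycle_graph_iff up_def down_def by auto
  have lt: "up < n" "down < n"
    using assms(1) unfolding up_def down_def by auto
  have up: "int up = (if int u = int n - 1 then 0 else int u + 1)"
    using assms(1) unfolding up_def by auto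
  have down: "int down = (if int u = 0 then int n - 1 else int u - 1)"
    using assms(1) unfolding down_def by auto
  \<comment> \<open>If no shortest arc to \<open>w\<close> goes up, then one goes down.\<close>
  have "int (cyc_dist n up w) = int (cyc_dist n u w) - 1 \<or>
        int (cyc_dist n down w) = int (cyc_dist n u w) - 1"
    unfolding int_cyc_dist[OF assms(1,2)] int_cyc_dist[OF lt(1) assms(2)]
      int_cyc_dist[OF lt(2) assms(2)]
    using up down assms(1,2) \<open>u \<noteq> w\<close> n
    by (smt (verit) of_nat_0_le_iff of_nat_less_iff of_nat_eq_iff)
  then show ?thesis
    using arcs assms(3) by auto
qed

lemma graph_dist_cycle_graph:
  assumes "u < n" "w < n"
  shows "graph_dist (cycle_graph n) u w = real (cyc_dist n u w)"
proof -
  interpret graph "cycle_graph n" by (rule graph_cycle_graph)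
  have lower: "cyc_dist n u w \<le> length p" if "awalk u p w" for p u
    using that
  proof (induction p arbitrary: u)
    case Nil
    then show ?case by (simp add: awalk_Nil_iff)
  next
    case (Cons e p)
    obtain v where e: "e = (u, v)" "(u, v) \<in> arcs (cycle_graph n)" "awalk v p w"
      using Cons.prems by (cases e) (auto simp: awalk_Cons_iff)
    show ?case
      using cyc_dist_step_le[OF e(2) assms(2)] Cons.IH[OF e(3)] by simp
  qed
  have upper: "\<exists>p. awalk u p w \<and> length p = d" if "u < n" "cyc_dist n u w = d" for d u
    using that
  proof (induction d arbitrary: u)
    case 0
    then have "u = w"
      using assms by (auto simp: cyc_dist_def min_def split: if_splits)
    then show ?case
      using 0 by (intro exI[of _ "[]"]) (simp add: awalk_Nil_iff)
  next
    case (Suc d)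
    obtain v where v: "(u, v) \<in> arcs (cycle_graph n)" "cyc_dist n v w = d"
      using cyc_dist_step_closer[OF _ assms(2)] Suc.prems by blast
    then obtain p where "awalk v p w" "length p = d"
      using Suc.IH[of v] by (auto simp: arcs_cycle_graph_iff)
    then show ?case
      using v by (intro exI[of _ "(u, v) # p"]) (simp add: awalk_Cons_iff)
  qed
  obtain p where p: "awalk u p w" "length p = cyc_dist n u w"
    using upper assms by blast
  have "\<mu> (\<lambda>_. 1) u w = ereal (real (cyc_dist n u w))"
  proof (rule antisym)
    show "\<mu> (\<lambda>_. 1) u w \<le> ereal (real (cyc_dist n u w))"
      using min_cost_le_walk_cost[OF p(1), of "\<lambda>_. 1"] p(2) by (simp add: awalk_cost_unit)
    show "ereal (real (cyc_dist n u w)) \<le> \<mu> (\<lambda>_. 1) u w"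
      unfolding \<mu>_def using lower by (intro INF_greatest) (simp add: awalk_cost_unit)
  qed
  then show ?thesis
    by (simp add: graph_dist_def)
qed

section \<open>Wiener index, one vertex at a time\<close>

lemma wiener_insert:
  assumes "finite A" "x \<notin> A" "insert x A \<subseteq> {..<n}"
  shows "wiener (cycle_graph n) (insert x A) =
    wiener (cycle_graph n) A + real (\<Sum>y\<in>A. cyc_dist n x y)"
proof -
  interpret graph "cycle_graph n" by (rule graph_cycle_graph)
  have eq: "nsets (insert x A) 2 = nsets A 2 \<union> (\<lambda>y. {x, y}) ` A"
    using assms(2) by (auto simp: nsets_2_eq)
  have disj: "nsets A 2 \<inter> (\<lambda>y. {x, y}) ` A = {}"
    using assms(2) by auto
  have inj: "inj_on (\<lambda>y. {x, y}) A"
    by (auto simp: inj_on_def doubleton_eq_iff)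
  have "(\<Sum>e\<in>(\<lambda>y. {x, y}) ` A. pair_dist (cycle_graph n) e) = (\<Sum>y\<in>A. real (cyc_dist n x y))"
    unfolding sum.reindex[OF inj] using assms(3)
    by (intro sum.cong) (auto simp: pair_dist_doubleton graph_dist_cycle_graph)
  then show ?thesis
    unfolding wiener_def eq using assms(1) disj
    by (subst sum.union_disjoint) (auto simp: finite_imp_finite_nsets)
qed

lemma wiener_empty [simp]: "wiener G {} = 0"
  by (simp add: wiener_def nsets_2_eq) 

section \<open>The largest Wiener index for a given number of vertices\<close>

text \<open>\<open>gain n j\<close> is the increase of the largest Wiener index when a set of \<open>j\<close> vertices of the
  \<open>n\<close>-cycle gets one more vertex. It is $j \lceil n/2 \rceil / 2$ for even $j$ and
  $(j+1) \lfloor n/2 \rfloor / 2$ for odd $j$.\<close>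

definition gain :: "nat \<Rightarrow> nat \<Rightarrow> nat" where
  "gain n j = (if even j then (j div 2) * ((n + 1) div 2) else ((j + 1) div 2) * (n div 2))"

text \<open>That this number is indeed the maximum over all sets of \<open>m\<close> vertices is the content of
  \<open>wiener_cycle_graph_le\<close> and \<open>wiener_zigzag_block\<close>. Its definition as a sum of gains
  reduces convexity in \<open>m\<close> to monotonicity of \<^const>\<open>gain\<close>.\<close>

definition max_wiener :: "nat \<Rightarrow> nat \<Rightarrow> nat" where
  "max_wiener n m = (\<Sum>j<m. gain n j)"

text \<open>Two successive gains add up to a simpler expression, because
  $\lceil n/2 \rceil + \lfloor n/2 \rfloor = n$. This is why the upper bound below removes
  vertices in pairs.\<close>

lemma gain_add_gain_Suc:
  "gain n m + gain n (Suc m) = ((m + 1) div 2) * n + (if even m then n div 2 else 0)"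
proof -
  have n: "(n + 1) div 2 + n div 2 = n" by presburger
  show ?thesis
  proof (cases "even m")
    case True
    then obtain q where "m = 2 * q" by blast
    then show ?thesis
      using arg_cong[OF n, of "\<lambda>x. q * x"] by (simp add: gain_def algebra_simps)
  next
    case False
    then obtain q where "m = 2 * q + 1" by (auto elim: oddE)
    then show ?thesis
      using arg_cong[OF n, of "\<lambda>x. (q + 1) * x"] by (simp add: gain_def algebra_simps)
  qed
qed

section \<open>The upper bound\<close>

lemma exists_element_of_rank:
  fixes S :: "'a :: linorder set"
  assumes "finite S" "k < card S"
  shows "\<exists>v\<in>S. card {w \<in> S. w < v} = k"
  using assms
proof (induction k arbitrary: S)
  case 0
  then have "S \<noteq> {}" by auto
  then have "Min S \<in> S" "{w \<in> S. w < Min S} = {}"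
    using 0 by (auto simp: not_less)
  then show ?case by (metis card.empty)
next
  case (Suc k)
  then have ne: "S \<noteq> {}" by auto
  let ?T = "S - {Min S}"
  have "k < card ?T"
    using Suc.prems ne by simp
  then obtain v where v: "v \<in> ?T" "card {w \<in> ?T. w < v} = k"
    using Suc.IH[of ?T] Suc.prems by auto
  have "Min S < v"
    using v(1) Min_le[OF Suc.prems(1), of v] by auto
  then have "{w \<in> S. w < v} = insert (Min S) {w \<in> ?T. w < v}"
    using Min_in[OF Suc.prems(1) ne] by auto
  then have "card {w \<in> S. w < v} = Suc k"
    using v(2) Suc.prems(1) by simp
  then show ?case using v(1) by blast
qed

text \<open>The next two facts hold because the distance from \<open>w\<close> to each of \<open>u\<close> and \<open>v\<close> is at most the
  length of the part of the arc through \<open>w\<close> that joins them, and the two parts together make up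
  one of the two arcs between \<open>u\<close> and \<open>v\<close>.\<close>

lemma cyc_dist_add_inside:
  assumes "u \<le> w" "w \<le> v"
  shows "cyc_dist n u w + cyc_dist n v w \<le> v - u"
proof -
  have "cyc_dist n u w \<le> w - u" "cyc_dist n v w \<le> v - w"
    using assms by (simp_all add: cyc_dist_ordered cyc_dist_commute[of n v w])
  then show ?thesis using assms by linarith
qed

lemma cyc_dist_add_outside:
  assumes "u \<le> v" "v \<le> w" "w < n"
  shows "cyc_dist n u w + cyc_dist n v w \<le> n - (v - u)"
proof -
  have "cyc_dist n u w \<le> n - (w - u)" "cyc_dist n v w \<le> w - v"
    using assms by (simp_all add: cyc_dist_ordered)
  then show ?thesis using assms by linarith
qed

text \<open>The proof removes two elements \<open>u\<close> and \<open>v\<close> of \<open>A\<close> that split the other \<open>m\<close> elements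
  between the two arcs from \<open>u\<close> to \<open>v\<close> as evenly as possible. If the arcs have lengths \<open>l\<close> and
  \<open>r = n - l\<close>, then an element on an arc contributes at most the length of that arc to the
  distances from \<open>u\<close> and \<open>v\<close>. For even \<open>m\<close> the total is at most $(m/2)(l + r)$ plus the
  distance of \<open>u\<close> and \<open>v\<close>, which is at most \<open>n div 2\<close>. For odd \<open>m\<close> the arc of length \<open>l\<close> has one
  element less than the other, and the distance of \<open>u\<close> and \<open>v\<close>, which is at most \<open>l\<close>, makes up
  for it. Either way this is the sum of two successive gains.\<close>

lemma wiener_cycle_graph_le:
  assumes "A \<subseteq> {..<n}"
  shows "wiener (cycle_graph n) A \<le> real (max_wiener n (card A))"
  using assms
proof (induction "card A" arbitrary: A rule: less_induct)
  case less
  have fin: "finite A" using less.prems finite_subset by blast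
  consider "card A = 0" | "card A = 1" | m where "card A = Suc (Suc m)"
    by (metis One_nat_def nat.exhaust)
  then show ?case
  proof cases
    case 1
    then show ?thesis using fin by simp
  next
    case 2
    then obtain x where "A = {x}" by (auto simp: card_1_singleton_iff)
    then show ?thesis
      using wiener_insert[of "{}" x n] less.prems by simp
  next
    case m: 3
    define u where "u = Min A"
    have A: "A \<noteq> {}" using m by auto
    then have u: "u \<in> A" "\<And>w. w \<in> A \<Longrightarrow> u \<le> w"
      using fin by (simp_all add: u_def)
    have "m div 2 < card (A - {u})" using m u fin by simp
    then obtain v where v: "v \<in> A - {u}" "card {w \<in> A - {u}. w < v} = m div 2"
      using exists_element_of_rank[of "A - {u}"] fin by auto
    define X where "X = {w \<in> A - {u}. w < v}"
    define Y where "Y = {w \<in> A. v < w}"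
    let ?d = "cyc_dist n"
    have uv: "u < v" "v < n" using u(2)[of v] v(1) less.prems by auto
    have XY: "finite X" "finite Y" "X \<inter> Y = {}" "u \<notin> X \<union> Y" "v \<notin> X \<union> Y"
      "A = insert u (insert v (X \<union> Y))"
      using fin u(1) v(1) uv(1) u(2) by (auto simp: X_def Y_def not_less dest: le_neq_trans)
    have "card (insert u (insert v (X \<union> Y))) = Suc (Suc (card (X \<union> Y)))"
      using XY(1,2,4,5) uv by simp
    then have "card (X \<union> Y) = m"
      unfolding XY(6)[symmetric] m by simp
    moreover have "card X = m div 2"
      using v(2) by (simp only: X_def)
    ultimately have card: "card X = m div 2" "card Y = m - m div 2" "card (X \<union> Y) = m"
      using XY(1-3) by (simp_all add: card_Un_disjoint)
    have "X \<union> Y \<subseteq> {..<n}"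
      using less.prems by (auto simp: X_def Y_def)
    from this less.hyps[of "X \<union> Y"] have IH: "wiener (cycle_graph n) (X \<union> Y) \<le> real (max_wiener n m)"
      by (simp add: card(3) m)
    have "u \<notin> insert v (X \<union> Y)" "finite (insert v (X \<union> Y))"
      "insert u (insert v (X \<union> Y)) \<subseteq> {..<n}"
      using XY(1,2,4) uv less.prems unfolding XY(6)[symmetric] by simp_all
    from wiener_insert[OF this(2,1,3)]
    have insert_u: "wiener (cycle_graph n) A = wiener (cycle_graph n) (insert v (X \<union> Y)) +
        real (\<Sum>y\<in>insert v (X \<union> Y). ?d u y)"
      unfolding XY(6)[symmetric] .
    have "finite (X \<union> Y)" "insert v (X \<union> Y) \<subseteq> {..<n}"
      using XY(1,2) \<open>X \<union> Y \<subseteq> {..<n}\<close> uv by auto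
    from wiener_insert[OF this(1) XY(5) this(2)]
    have insert_v: "wiener (cycle_graph n) (insert v (X \<union> Y)) =
        wiener (cycle_graph n) (X \<union> Y) + real (\<Sum>y\<in>X \<union> Y. ?d v y)" .
    have "(\<Sum>y\<in>insert v (X \<union> Y). ?d u y) = ?d u v + (\<Sum>y\<in>X \<union> Y. ?d u y)"
      using XY(1,2,5) by simp
    then have "wiener (cycle_graph n) A = wiener (cycle_graph n) (X \<union> Y) +
        real (\<Sum>y\<in>X \<union> Y. ?d v y) + real (?d u v + (\<Sum>y\<in>X \<union> Y. ?d u y))"
      using insert_u insert_v by simp
    also have "\<dots> = wiener (cycle_graph n) (X \<union> Y) +
        real (?d u v + (\<Sum>y\<in>X. ?d u y + ?d v y) + (\<Sum>y\<in>Y. ?d u y + ?d v y))"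
      using XY(1-3) by (simp add: sum.union_disjoint sum.distrib)
    finally have W: "wiener (cycle_graph n) A = \<dots>" .
    have sumX: "(\<Sum>y\<in>X. ?d u y + ?d v y) \<le> card X * (v - u)"
      using u by (intro sum_bounded_above[THEN order_trans]) 
        (auto intro!: cyc_dist_add_inside simp: X_def)
    have sumY: "(\<Sum>y\<in>Y. ?d u y + ?d v y) \<le> card Y * (n - (v - u))"
      using u uv less.prems by (intro sum_bounded_above[THEN order_trans])
        (auto intro!: cyc_dist_add_outside simp: Y_def)
    have duv: "?d u v \<le> v - u" "?d u v \<le> n div 2"
      using uv by (simp_all add: cyc_dist_ordered)
    define l where "l = v - u"
    define r where "r = n - l"
    \<comment> \<open>In terms of the two arc lengths the inequality contains no subtraction of products.\<close>
    have n: "n = l + r" using uv by (simp add: l_def r_def)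
    have "?d u v + card X * l + card Y * r \<le> gain n m + gain n (Suc m)"
    proof (cases "even m")
      case True
      then obtain q where "m = 2 * q" by blast
      then show ?thesis
        using duv(2) unfolding gain_add_gain_Suc card by (simp add: n algebra_simps)
    next
      case False
      then obtain q where "m = 2 * q + 1" by (auto elim: oddE)
      then show ?thesis
        using duv(1) unfolding gain_add_gain_Suc card l_def[symmetric]
        by (simp add: n algebra_simps)
    qed
    then have "?d u v + (\<Sum>y\<in>X. ?d u y + ?d v y) + (\<Sum>y\<in>Y. ?d u y + ?d v y)
        \<le> gain n m + gain n (Suc m)"
      using sumX sumY unfolding r_def l_def by linarith
    then have "real (?d u v + (\<Sum>y\<in>X. ?d u y + ?d v y) + (\<Sum>y\<in>Y. ?d u y + ?d v y))
        \<le> real (gain n m + gain n (Suc m))"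
      by (simp only: of_nat_le_iff)
    then show ?thesis
      using IH unfolding W m max_wiener_def sum.lessThan_Suc of_nat_add by linarith
  qed
qed

section \<open>Sets that attain the bound\<close>

text \<open>This enumeration of the vertices jumps back and forth between the two halves of the cycle, so
  that consecutive vertices are antipodal or nearly so: $0, \lceil n/2 \rceil, 1,
  \lceil n/2 \rceil + 1, \ldots$ Consecutive stretches of it therefore have a large Wiener index.\<close>

definition zigzag :: "nat \<Rightarrow> nat \<Rightarrow> nat" where
  "zigzag n p = (if even p then p div 2 else (n + 1) div 2 + p div 2)"

lemma zigzag_less:
  assumes "p < n"
  shows "zigzag n p < n"
proof (cases "even p")
  case False
  then obtain q where "p = 2 * q + 1" by (auto elim: oddE)
  then show ?thesis using assms by (simp add: zigzag_def)
qed (use assms in \<open>simp add: zigzag_def\<close>)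

lemma zigzag_less_half_iff:
  assumes "p < n"
  shows "zigzag n p < (n + 1) div 2 \<longleftrightarrow> even p"
proof (cases "even p")
  case True
  then obtain q where "p = 2 * q" by blast
  then show ?thesis using assms by (simp add: zigzag_def)
qed (simp add: zigzag_def)

lemma zigzag_eq_iff:
  assumes "p < n" "q < n"
  shows "zigzag n p = zigzag n q \<longleftrightarrow> p = q"
proof
  assume eq: "zigzag n p = zigzag n q"
  then have parity: "even p \<longleftrightarrow> even q"
    using zigzag_less_half_iff[OF assms(1)] zigzag_less_half_iff[OF assms(2)] by simp
  then have "p div 2 = q div 2"
    using eq by (cases "even p") (simp_all add: zigzag_def)
  with parity show "p = q"
    by (metis even_iff_mod_2_eq_zero odd_iff_mod_2_eq_one div_mult_mod_eq)
qed simp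

lemma bij_betw_zigzag: "bij_betw (zigzag n) {..<n} {..<n}"
proof -
  have "inj_on (zigzag n) {..<n}" "zigzag n ` {..<n} \<subseteq> {..<n}"
    by (auto simp: inj_on_def zigzag_eq_iff zigzag_less)
  then show ?thesis
    by (simp add: bij_betw_def endo_inj_surj)
qed

lemma cyc_dist_zigzag_even:
  assumes "t + i < n" "even t"
  shows "cyc_dist n (zigzag n i) (zigzag n (t + i)) = t div 2"
proof -
  have "zigzag n (t + i) = zigzag n i + t div 2"
    using assms by (auto simp: zigzag_def elim!: evenE)
  then show ?thesis
    using assms by (simp add: cyc_dist_ordered)
qed

text \<open>For even \<open>n\<close> a jump with the same offset is shorter by one if it starts in the upper half
  of the cycle. The correction term is added on the left to avoid truncated subtraction.\<close>

lemma cyc_dist_zigzag_odd: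
  assumes "t + i < n" "odd t"
  shows "cyc_dist n (zigzag n i) (zigzag n (t + i)) + (if even i then t div 2 else (t + 1) div 2) =
    (if even i then n div 2 else (n + 1) div 2)"
proof -
  obtain s where t: "t = 2 * s + 1" using assms by (auto elim: oddE)
  define h where "h = n div 2"
  define e where "e = (n + 1) div 2"
  have n: "n = h + e" and he: "h \<le> e" "e \<le> h + 1"
    unfolding h_def e_def by presburger+
  show ?thesis
  proof (cases "even i")
    case True
    then obtain a where i: "i = 2 * a" by blast
    have z: "zigzag n i = a" "zigzag n (t + i) = a + (s + e)"
      by (simp_all add: zigzag_def i t e_def)
    have s: "s \<le> h" using assms(1) he unfolding t i n by linarith
    have "cyc_dist n (zigzag n i) (zigzag n (t + i)) = min (s + e) (n - (s + e))"
      unfolding z by (simp add: cyc_dist_ordered)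
    also have "\<dots> = h - s"
      using he n by simp
    finally show ?thesis
      using True s unfolding h_def[symmetric] e_def[symmetric] t by simp
  next
    case False
    then obtain a where i: "i = 2 * a + 1" by (auto elim: oddE)
    have z: "zigzag n i = e + a" "zigzag n (t + i) = a + s + 1"
      by (simp_all add: zigzag_def i t e_def)
    have s: "s + 1 \<le> e" using assms(1) he unfolding t i n by linarith
    have "cyc_dist n (zigzag n i) (zigzag n (t + i)) = min (e - (s + 1)) (n - (e - (s + 1)))"
      unfolding z using s by (subst cyc_dist_commute) (simp add: cyc_dist_ordered)
    also have "\<dots> = e - (s + 1)"
      using he n s by simp
    finally show ?thesis
      using False s unfolding h_def[symmetric] e_def[symmetric] t by simp
  qed
qed

text \<open>The distances from vertex number \<open>j\<close> to the vertices at offsets \<open>2 * s + 1\<close> and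
  \<open>2 * s + 2\<close> add up to a number that does not depend on \<open>s\<close>.\<close>

lemma sum_cyc_dist_zigzag:
  assumes "m \<le> j" "j < n"
  shows "(\<Sum>i\<in>{j - m..<j}. cyc_dist n (zigzag n i) (zigzag n j)) +
      (if even j \<and> odd m then (m + 1) div 2 else 0) =
    ((m + 1) div 2) * (if even j then (n + 1) div 2 else n div 2) +
      (if odd j \<and> even m then m div 2 else 0)"
  using assms(1)
proof (induction m)
  case 0
  then show ?case by simp
next
  case (Suc m)
  define i where "i = j - Suc m"
  have j: "j = Suc m + i" using Suc.prems by (simp add: i_def)
  have "{i..<j} = insert i {j - m..<j}" using j by auto
  then have sum: "(\<Sum>i\<in>{i..<j}. cyc_dist n (zigzag n i) (zigzag n j)) =
      cyc_dist n (zigzag n i) (zigzag n j) +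
      (\<Sum>i\<in>{j - m..<j}. cyc_dist n (zigzag n i) (zigzag n j))"
    using j by simp
  have ev: "even (Suc m) \<Longrightarrow> cyc_dist n (zigzag n i) (zigzag n j) = Suc m div 2"
    using cyc_dist_zigzag_even[of "Suc m" i n] assms(2) j by simp
  have od: "odd (Suc m) \<Longrightarrow> cyc_dist n (zigzag n i) (zigzag n j) +
      (if odd j then m div 2 else (m + 2) div 2) = (if odd j then n div 2 else (n + 1) div 2)"
    using cyc_dist_zigzag_odd[of "Suc m" i n] assms(2) j by auto
  show ?case
  proof (cases "even m")
    case True
    then obtain q where "m = 2 * q" by blast
    then show ?thesis
      using Suc od unfolding i_def[symmetric] sum
      by (cases "even j") (simp_all add: algebra_simps)
  next
    case False
    then obtain q where "m = 2 * q + 1" by (auto elim: oddE)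
    then show ?thesis
      using Suc ev unfolding i_def[symmetric] sum
      by (cases "even j") (simp_all add: algebra_simps)
  qed
qed

text \<open>The arithmetic of the induction step below: \<open>s\<close> is the increase of the Wiener index when the
  vertex number \<open>a + m\<close> joins a block of \<open>m\<close> vertices starting at number \<open>a\<close>.\<close>

lemma gain_defect:
  fixes s :: nat
  assumes "s + (if even (a + m) \<and> odd m then (m + 1) div 2 else 0) =
    ((m + 1) div 2) * (if even (a + m) then (n + 1) div 2 else n div 2) +
      (if odd (a + m) \<and> even m then m div 2 else 0)"
  shows "s + (if odd a \<and> even (Suc m) \<and> even n then Suc m div 2 else 0) =
    gain n m + (if odd a \<and> even m \<and> even n then m div 2 else 0)"
proof -
  have n: "(n + 1) div 2 = (if even n then n div 2 else n div 2 + 1)"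
    by presburger
  have m: "(m + 1) div 2 = (if even m then m div 2 else m div 2 + 1)"
    by presburger
  show ?thesis
    using assms unfolding n m gain_def Suc_eq_plus1
    by (cases "even m"; cases "even a"; cases "even n") simp_all
qed

text \<open>A nonempty block of even length that starts at an odd position of an even cycle contains two vertices
  whose antipodes are missing, and it falls short of the bound by half its length. The defect
  disappears again as soon as the length becomes odd, so the exact value of the defect is what
  the induction on the length has to carry along.\<close>

lemma wiener_zigzag_block_defect:
  assumes "a + m \<le> n"
  shows "wiener (cycle_graph n) (zigzag n ` {a..<a + m}) +
      real (if odd a \<and> even m \<and> even n then m div 2 else 0) = real (max_wiener n m)"
  using assms
proof (induction m)
  case 0
  then show ?case by (simp add: max_wiener_def)
next
  case (Suc m)
  let ?z = "zigzag n"
  let ?S = "\<Sum>i\<in>{a..<a + m}. cyc_dist n (?z i) (?z (a + m))"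
  have inj: "inj_on ?z {a..<a + m}"
    using Suc.prems by (auto simp: inj_on_def zigzag_eq_iff)
  have "?z ` {a..<a + Suc m} = insert (?z (a + m)) (?z ` {a..<a + m})"
    by (simp add: atLeastLessThanSuc)
  moreover have "?z (a + m) \<notin> ?z ` {a..<a + m}"
    using Suc.prems by (auto simp: zigzag_eq_iff)
  moreover have "insert (?z (a + m)) (?z ` {a..<a + m}) \<subseteq> {..<n}"
    using Suc.prems by (auto intro: zigzag_less)
  ultimately have "wiener (cycle_graph n) (?z ` {a..<a + Suc m}) =
      wiener (cycle_graph n) (?z ` {a..<a + m}) + real (\<Sum>y\<in>?z ` {a..<a + m}. cyc_dist n (?z (a + m)) y)"
    using wiener_insert by simp
  also have "(\<Sum>y\<in>?z ` {a..<a + m}. cyc_dist n (?z (a + m)) y) = ?S"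
    by (simp add: sum.reindex[OF inj] cyc_dist_commute)
  finally have W: "wiener (cycle_graph n) (?z ` {a..<a + Suc m}) =
      wiener (cycle_graph n) (?z ` {a..<a + m}) + real ?S" .
  have S: "?S + (if even (a + m) \<and> odd m then (m + 1) div 2 else 0) =
    ((m + 1) div 2) * (if even (a + m) then (n + 1) div 2 else n div 2) +
      (if odd (a + m) \<and> even m then m div 2 else 0)"
    using sum_cyc_dist_zigzag[of m "a + m" n] Suc.prems by simp
  have "?S + (if odd a \<and> even (Suc m) \<and> even n then Suc m div 2 else 0) =
    gain n m + (if odd a \<and> even m \<and> even n then m div 2 else 0)"
    by (rule gain_defect[OF S])
  then have "real ?S + real (if odd a \<and> even (Suc m) \<and> even n then Suc m div 2 else 0) =
    real (gain n m) + real (if odd a \<and> even m \<and> even n then m div 2 else 0)"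
    by (metis of_nat_add)
  moreover have "real (max_wiener n (Suc m)) = real (max_wiener n m) + real (gain n m)"
    by (simp add: max_wiener_def)
  moreover have "wiener (cycle_graph n) (?z ` {a..<a + m}) +
      real (if odd a \<and> even m \<and> even n then m div 2 else 0) = real (max_wiener n m)"
    using Suc by simp
  ultimately show ?case
    unfolding W by linarith
qed

lemma wiener_zigzag_block:
  assumes "a + m \<le> n" "odd n \<or> even a \<or> odd m"
  shows "wiener (cycle_graph n) (zigzag n ` {a..<a + m}) = real (max_wiener n m)"
  using wiener_zigzag_block_defect[OF assms(1)] assms(2) by (auto split: if_splits)

section \<open>Convexity and majorization\<close>

text \<open>Summation by parts: with $D_s = \sum_{i<s} d_i$ the sum is
  $c_{k-1} D_k + \sum_{i<k-1} (c_i - c_{i+1}) D_{i+1}$, where the first term vanishes and all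
  others are nonnegative. The induction compares each partial sum with the boundary term
  $c_s D_{s+1}$.\<close>

lemma sum_mult_nonneg_if_partial_sums_nonneg:
  fixes c d :: "nat \<Rightarrow> real"
  assumes decr: "\<And>i. Suc i < k \<Longrightarrow> c (Suc i) \<le> c i"
    and partial: "\<And>s. s \<le> k \<Longrightarrow> 0 \<le> (\<Sum>i<s. d i)" and total: "(\<Sum>i<k. d i) = 0"
  shows "0 \<le> (\<Sum>i<k. c i * d i)"
proof (cases k)
  case (Suc l)
  have "c s * (\<Sum>i<Suc s. d i) \<le> (\<Sum>i<Suc s. c i * d i)" if "s < k" for s
    using that
  proof (induction s)
    case (Suc s)
    have "c (Suc s) * (\<Sum>i<Suc s. d i) \<le> c s * (\<Sum>i<Suc s. d i)"
      using decr[of s] partial[of "Suc s"] Suc.prems by (intro mult_right_mono) auto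
    then have "c (Suc s) * (\<Sum>i<Suc s. d i) \<le> (\<Sum>i<Suc s. c i * d i)"
      using Suc.IH Suc.prems by linarith
    moreover have "c (Suc s) * (\<Sum>i<Suc (Suc s). d i) =
        c (Suc s) * (\<Sum>i<Suc s. d i) + c (Suc s) * d (Suc s)"
      by (simp add: algebra_simps)
    ultimately show ?case by simp
  qed simp
  from this[of l] show ?thesis using total Suc by simp
qed simp

text \<open>The sequence of partial sums of a monotone sequence is convex, so it lies above its tangent at
  every point \<open>x\<close>; the slope \<open>c x\<close> is the increment that follows \<open>x\<close>.\<close>

lemma sum_lessThan_tangent:
  fixes c :: "nat \<Rightarrow> nat"
  assumes "mono_on {..N} c" "x \<le> N" "y \<le> N"
  shows "real (\<Sum>j<x. c j) + real (c x) * (real y - real x) \<le> real (\<Sum>j<y. c j)"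
proof (cases "x \<le> y")
  case True
  have "(y - x) * c x \<le> (\<Sum>j\<in>{x..<y}. c j)"
    using assms sum_bounded_below[of "{x..<y}" "c x" c] by (auto simp: mono_on_def)
  then have "(\<Sum>j<x. c j) + (y - x) * c x \<le> (\<Sum>j<y. c j)"
    using sum.atLeastLessThan_concat[of 0 x y c] True by (simp add: atLeast0LessThan)
  then have "real ((\<Sum>j<x. c j) + (y - x) * c x) \<le> real (\<Sum>j<y. c j)"
    by (simp only: of_nat_le_iff)
  then show ?thesis
    using True by (simp add: of_nat_diff mult.commute del: of_nat_sum)
next
  case False
  have "(\<Sum>j\<in>{y..<x}. c j) \<le> (x - y) * c x"
    using assms sum_bounded_above[of "{y..<x}" c "c x"] by (auto simp: mono_on_def)
  then have "(\<Sum>j<x. c j) \<le> (\<Sum>j<y. c j) + (x - y) * c x"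
    using sum.atLeastLessThan_concat[of 0 y x c] False by (simp add: atLeast0LessThan)
  then have "real (\<Sum>j<x. c j) \<le> real ((\<Sum>j<y. c j) + (x - y) * c x)"
    by (simp only: of_nat_le_iff)
  then show ?thesis
    using False
    by (simp only: of_nat_add of_nat_mult of_nat_diff nat_le_linear not_le less_imp_le)
      (simp add: algebra_simps)
qed

lemma sort_map_real: "sort (map real xs) = map real (sort xs)"
  by (rule properties_for_sort) (simp_all add: sorted_map)

text \<open>Karamata's inequality for the convex function $m \mapsto \sum_{j<m} c_j$ on $\{0,\ldots,N\}$.
  With both lists in non-increasing order, the tangent inequality at the entries of \<open>xs\<close> bounds
  the difference from below by a sum of slopes times differences; the slopes do not increase, the
  partial sums of the differences are nonnegative by majorization, and summation by parts
  applies.\<close>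

lemma sum_list_le_if_majorized:
  fixes c :: "nat \<Rightarrow> nat" and xs ys :: "nat list"
  assumes maj: "majorized (map real xs) (map real ys)" and mono: "mono_on {..N} c"
    and xs: "set xs \<subseteq> {..N}" and ys: "set ys \<subseteq> {..N}"
  shows "(\<Sum>m\<leftarrow>xs. \<Sum>j<m. c j) \<le> (\<Sum>m\<leftarrow>ys. \<Sum>j<m. c j)"
proof -
  define k where "k = length xs"
  define X where "X = rev (sort xs)"
  define Y where "Y = rev (sort ys)"
  let ?\<phi> = "\<lambda>m. \<Sum>j<m. c j"
  let ?d = "\<lambda>i. real (Y ! i) - real (X ! i)"
  have len: "length X = k" "length Y = k"
    using maj by (auto simp: majorized_def k_def X_def Y_def)
  have take: "sum_list (take s (map real Z)) = (\<Sum>i<s. real (Z ! i))" if "s \<le> length Z" for s Z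
    using that by (simp add: sum_list_sum_nth atLeast0LessThan)
  have rev: "rev (sort (map real xs)) = map real X" "rev (sort (map real ys)) = map real Y"
    by (simp_all add: sort_map_real X_def Y_def rev_map)
  have total: "(\<Sum>i<k. ?d i) = 0"
    using maj take[of k X] take[of k Y] len
    unfolding majorized_def rev by (simp add: sum_subtractf)
  have partial: "0 \<le> (\<Sum>i<s. ?d i)" if "s \<le> k" for s
  proof -
    consider "s = 0" | "s = k" | "s \<in> {1..<k}" using \<open>s \<le> k\<close> by fastforce
    then show ?thesis
    proof cases
      case 3
      then have "sum_list (take s (map real X)) \<le> sum_list (take s (map real Y))"
        using maj unfolding majorized_def rev by (simp add: k_def)
      then show ?thesis
        using take[of s X] take[of s Y] len that by (simp add: sum_subtractf)
    qed (use total in simp_all)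
  qed
  have elem: "X ! i \<le> N" "Y ! i \<le> N" if "i < k" for i
    using nth_mem[of i X] nth_mem[of i Y] that len xs ys by (auto simp: X_def Y_def)
  have decr: "real (c (X ! Suc i)) \<le> real (c (X ! i))" if "Suc i < k" for i
  proof -
    have "sorted_wrt (\<ge>) X" by (simp add: X_def sorted_wrt_rev)
    then have "X ! Suc i \<le> X ! i"
      using that len by (simp add: sorted_wrt_iff_nth_less)
    then show ?thesis
      using mono elem that by (simp add: mono_on_def)
  qed
  have "0 \<le> (\<Sum>i<k. real (c (X ! i)) * ?d i)"
    using decr partial total by (rule sum_mult_nonneg_if_partial_sums_nonneg)
  also have "\<dots> \<le> (\<Sum>i<k. real (?\<phi> (Y ! i)) - real (?\<phi> (X ! i)))"
  proof (rule sum_mono)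
    fix i assume "i \<in> {..<k}"
    then show "real (c (X ! i)) * ?d i \<le> real (?\<phi> (Y ! i)) - real (?\<phi> (X ! i))"
      using sum_lessThan_tangent[OF mono, of "X ! i" "Y ! i"] elem by simp
  qed
  finally have "real (\<Sum>i<k. ?\<phi> (X ! i)) \<le> real (\<Sum>i<k. ?\<phi> (Y ! i))"
    by (simp add: sum_subtractf)
  then have le: "(\<Sum>i<k. ?\<phi> (X ! i)) \<le> (\<Sum>i<k. ?\<phi> (Y ! i))"
    by (simp only: of_nat_le_iff)
  have sort: "(\<Sum>m\<leftarrow>rev (sort zs). ?\<phi> m) = (\<Sum>m\<leftarrow>zs. ?\<phi> m)" for zs
    by (simp flip: sum_mset_sum_list)
  have nth: "(\<Sum>m\<leftarrow>Z. ?\<phi> m) = (\<Sum>i<length Z. ?\<phi> (Z ! i))" for Z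
    by (simp add: sum_list_sum_nth atLeast0LessThan)
  have "(\<Sum>m\<leftarrow>xs. ?\<phi> m) = (\<Sum>i<k. ?\<phi> (X ! i))"
    by (rule trans[OF sort[of xs, folded X_def, symmetric] nth[of X, unfolded len]])
  moreover have "(\<Sum>m\<leftarrow>ys. ?\<phi> m) = (\<Sum>i<k. ?\<phi> (Y ! i))"
    by (rule trans[OF sort[of ys, folded Y_def, symmetric] nth[of Y, unfolded len]])
  ultimately show ?thesis
    using le by (simp only:)
qed

text \<open>The range matters for odd \<open>n\<close>: for even \<open>j\<close>, the inequality
  $(j/2) \lceil n/2 \rceil \le (j/2 + 1) \lfloor n/2 \rfloor$ amounts to
  $j/2 \le \lfloor n/2 \rfloor$, which is where \<open>j \<le> n\<close> enters.\<close>

lemma mono_on_gain: "mono_on {..n} (gain n)"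
proof -
  have step: "gain n j \<le> gain n (Suc j)" if "Suc j \<le> n" for j
  proof (cases "even j")
    case False
    have "n div 2 \<le> (n + 1) div 2" by simp
    then have "((j + 1) div 2) * (n div 2) \<le> ((j + 1) div 2) * ((n + 1) div 2)"
      by (rule mult_le_mono2)
    with False show ?thesis by (simp add: gain_def)
  next
    case True
    then obtain q where j: "j = 2 * q" by blast
    have "q * ((n + 1) div 2) \<le> (q + 1) * (n div 2)"
    proof (cases "even n")
      case True
      then show ?thesis by (auto elim: evenE)
    next
      case False
      then obtain r where "n = 2 * r + 1" by (auto elim: oddE)
      then show ?thesis using that j by simp
    qed
    then show ?thesis by (simp add: gain_def j)
  qed
  have "j \<le> n \<Longrightarrow> gain n i \<le> gain n j" if "i \<le> j" for i j
    using that
  proof (induction rule: dec_induct)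
    case (step j)
    then show ?case using \<open>\<And>j. Suc j \<le> n \<Longrightarrow> _\<close>[of j] by simp
  qed simp
  then show ?thesis by (auto simp: mono_on_def)
qed

section \<open>Colorings whose classes attain the bound simultaneously\<close>

text \<open>The interval of \<open>i\<close> has length \<open>c i\<close> and starts at \<open>b i\<close>. The parity condition excludes the
  defective blocks of \<open>wiener_zigzag_block_defect\<close>.\<close>

definition parity_tiling :: "('a \<Rightarrow> nat) \<Rightarrow> 'a set \<Rightarrow> ('a \<Rightarrow> nat) \<Rightarrow> bool" where
  "parity_tiling c I b \<longleftrightarrow> (\<forall>i\<in>I. even (c i) \<longrightarrow> even (b i)) \<and>
    disjoint_family_on (\<lambda>i. {b i..<b i + c i}) I \<and> (\<Union>i\<in>I. {b i..<b i + c i}) = {..<sum c I}"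

lemma parity_tiling_insert:
  assumes tiling: "parity_tiling c I b" and I: "finite I" "i \<notin> I"
    and parity: "even (c i) \<Longrightarrow> even (sum c I)"
  shows "parity_tiling c (insert i I) (b(i := sum c I))"
proof -
  define b' where "b' = b(i := sum c I)"
  have b': "b' j = b j" if "j \<in> I" for j
    using that I(2) by (auto simp: b'_def)
  have bi: "b' i = sum c I" by (simp add: b'_def)
  have union: "(\<Union>j\<in>I. {b' j..<b' j + c j}) = {..<sum c I}"
    using tiling b' by (simp add: parity_tiling_def)
  have "disjoint_family_on (\<lambda>j. {b' j..<b' j + c j}) I"
    using tiling b' by (simp add: parity_tiling_def disjoint_family_on_def)
  moreover have "{b' i..<b' i + c i} \<inter> (\<Union>j\<in>I. {b' j..<b' j + c j}) = {}"
    unfolding union bi by auto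
  ultimately have "disjoint_family_on (\<lambda>j. {b' j..<b' j + c j}) (insert i I)"
    using I(2) by (simp add: disjoint_family_on_insert)
  moreover have "(\<Union>j\<in>insert i I. {b' j..<b' j + c j}) = {..<sum c (insert i I)}"
    using I unfolding UN_insert union bi by auto
  moreover have "\<forall>j\<in>insert i I. even (c j) \<longrightarrow> even (b' j)"
    using tiling parity b' bi by (auto simp: parity_tiling_def)
  ultimately show ?thesis by (simp only: parity_tiling_def b'_def)
qed

text \<open>The intervals of even length come first: as long as all previous lengths are even, the next
  interval starts at an even position. The intervals of odd length follow in any order.\<close>

lemma exists_parity_tiling:
  assumes "finite I"
  shows "\<exists>b. parity_tiling c I b"
proof -
  define E where "E = {i \<in> I. even (c i)}"
  define D where "D = {i \<in> I. odd (c i)}"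
  have fin: "finite E" "finite D" using assms by (simp_all add: E_def D_def)
  have evens: "\<exists>b. parity_tiling c T b" if "finite T" "T \<subseteq> E" for T
    using that
  proof (induction T rule: finite_induct)
    case empty
    show ?case by (simp add: parity_tiling_def disjoint_family_on_def)
  next
    case (insert i T)
    have "even (sum c T)"
      using insert.prems by (intro dvd_sum) (auto simp: E_def)
    then show ?case
      using insert parity_tiling_insert[OF _ insert.hyps(1,2)] by blast
  qed
  have "\<exists>b. parity_tiling c (T \<union> E) b" if "finite T" "T \<subseteq> D" for T
    using that
  proof (induction T rule: finite_induct)
    case empty
    show ?case using evens[OF fin(1)] by simp
  next
    case (insert i T)
    have i: "i \<notin> T \<union> E" "odd (c i)"
      using insert.hyps(2) insert.prems by (auto simp: E_def D_def)
    have "finite (T \<union> E)" using insert.hyps(1) fin by simp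
    then show ?case
      unfolding Un_insert_left
      using insert i parity_tiling_insert[of c "T \<union> E" _ i] by blast
  qed
  from this[OF fin(2)] have "\<exists>b. parity_tiling c (D \<union> E) b" by simp
  moreover have "D \<union> E = I" by (auto simp: D_def E_def)
  ultimately show ?thesis by (simp only:)
qed

text \<open>The coloring gives color \<open>i\<close> to the block of the zigzag enumeration that a parity tiling
  assigns to \<open>i\<close>.\<close>

lemma exists_coloring_attaining_max_wiener:
  assumes "sum c {1..k} = n"
  shows "\<exists>f. (\<forall>v<n. f v \<in> {1..k}) \<and> (\<forall>i\<in>{1..k}. card (color_class (cycle_graph n) f i) = c i \<and>
    wiener (cycle_graph n) (color_class (cycle_graph n) f i) = real (max_wiener n (c i)))"
proof -
  obtain b where even: "\<forall>i\<in>{1..k}. even (c i) \<longrightarrow> even (b i)"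
    and disj: "disjoint_family_on (\<lambda>i. {b i..<b i + c i}) {1..k}"
    and union: "(\<Union>i\<in>{1..k}. {b i..<b i + c i}) = {..<n}"
    using exists_parity_tiling[of "{1..k}" c] assms by (auto simp: parity_tiling_def)
  define pos where "pos = inv_into {..<n} (zigzag n)"
  define f where "f v = (THE i. i \<in> {1..k} \<and> pos v \<in> {b i..<b i + c i})" for v
  have pos: "pos v < n" "zigzag n (pos v) = v" if "v < n" for v
    using that bij_betw_zigzag[of n] inv_into_into[of v "zigzag n" "{..<n}"]
      f_inv_into_f[of v "zigzag n" "{..<n}"] by (auto simp: pos_def bij_betw_def)
  have pos_zigzag: "pos (zigzag n p) = p" if "p < n" for p
    using that bij_betw_zigzag[of n] by (simp add: pos_def bij_betw_def)
  have f_eq: "f v = i" if "i \<in> {1..k}" "pos v \<in> {b i..<b i + c i}" for v i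
    unfolding f_def
  proof (rule the_equality)
    fix j assume j: "j \<in> {1..k} \<and> pos v \<in> {b j..<b j + c j}"
    show "j = i"
    proof (rule ccontr)
      assume "j \<noteq> i"
      then have "{b j..<b j + c j} \<inter> {b i..<b i + c i} = {}"
        using disj j that(1) unfolding disjoint_family_on_def by blast
      then show False using j that(2) by blast
    qed
  qed (use that in simp)
  have ex: "\<exists>i\<in>{1..k}. pos v \<in> {b i..<b i + c i}" if "v < n" for v
    using pos(1)[OF that] union by blast
  have le: "b i + c i \<le> n" if "i \<in> {1..k}" "c i > 0" for i
  proof -
    have "b i + c i - 1 \<in> (\<Union>i\<in>{1..k}. {b i..<b i + c i})"
      using that by (intro UN_I[of i]) auto
    then show ?thesis unfolding union using that by auto
  qed
  have class_eq: "color_class (cycle_graph n) f i = zigzag n ` {b i..<b i + c i}" if i: "i \<in> {1..k}" for i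
  proof (intro equalityI subsetI)
    fix v assume "v \<in> color_class (cycle_graph n) f i"
    then have v: "v < n" "f v = i" by (auto simp: color_class_def)
    then have "pos v \<in> {b i..<b i + c i}" using ex[OF v(1)] f_eq by blast
    then show "v \<in> zigzag n ` {b i..<b i + c i}"
      using pos(2)[OF v(1)] by (metis imageI)
  next
    fix v assume "v \<in> zigzag n ` {b i..<b i + c i}"
    then obtain p where p: "v = zigzag n p" "p \<in> {b i..<b i + c i}" by blast
    then have "p < n" using union i by blast
    then show "v \<in> color_class (cycle_graph n) f i"
      using f_eq[OF i, of v] p pos_zigzag zigzag_less by (simp add: color_class_def)
  qed
  have "f v \<in> {1..k}" if "v < n" for v
    using ex[OF that] f_eq by blast
  moreover have "card (color_class (cycle_graph n) f i) = c i" if i: "i \<in> {1..k}" for i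
  proof -
    have "{b i..<b i + c i} \<subseteq> {..<n}" using union i by blast
    with bij_betw_imp_inj_on[OF bij_betw_zigzag] have "inj_on (zigzag n) {b i..<b i + c i}"
      by (rule inj_on_subset)
    then show ?thesis by (simp add: class_eq[OF i] card_image)
  qed
  moreover have "wiener (cycle_graph n) (color_class (cycle_graph n) f i) = real (max_wiener n (c i))"
    if i: "i \<in> {1..k}" for i
  proof (cases "c i = 0")
    case True
    then show ?thesis by (simp add: class_eq[OF i] max_wiener_def)
  next
    case False
    moreover have "odd n \<or> even (b i) \<or> odd (c i)" using even i by blast
    ultimately show ?thesis
      using wiener_zigzag_block[of "b i" "c i" n] le[OF i] by (simp add: class_eq[OF i])
  qed
  ultimately show ?thesis by blast
qed

section \<open>Weak maximizers\<close>

lemma sum_card_color_class: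
  assumes "finite (verts G)" "f ` verts G \<subseteq> {1..k}"
  shows "(\<Sum>i=1..k. card (color_class G f i)) = card (verts G)"
proof -
  have "verts G = (\<Union>i\<in>{1..k}. color_class G f i)"
    using assms(2) by (auto simp: color_class_def)
  moreover have "card (\<Union>i\<in>{1..k}. color_class G f i) = (\<Sum>i=1..k. card (color_class G f i))"
    using assms(1) by (intro card_UN_disjoint) (auto simp: color_class_def)
  ultimately show ?thesis by simp
qed

text \<open>Every class obeys the upper bound for its size, and some coloring with the same class sizes
  attains all these bounds at once; it is surjective because no class size is zero. Hence a weak
  maximizer attains them as well.\<close>

lemma coloring_wiener_weak_maximizer:
  assumes "weak_maximizer (cycle_graph n) k f"
  shows "coloring_wiener (cycle_graph n) k f =
    real (\<Sum>m\<leftarrow>coloring_type (cycle_graph n) k f. max_wiener n m)"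
proof -
  let ?G = "cycle_graph n"
  define c where "c = (\<lambda>i. card (color_class ?G f i))"
  have surj: "f ` {..<n} = {1..k}"
    using assms by (simp add: weak_maximizer_def surj_coloring_def)
  then have "sum c {1..k} = n"
    using sum_card_color_class[of ?G f k] by (simp add: c_def)
  then obtain f' where f': "\<forall>v<n. f' v \<in> {1..k}"
    and attained: "\<And>i. i \<in> {1..k} \<Longrightarrow> card (color_class ?G f' i) = c i"
      "\<And>i. i \<in> {1..k} \<Longrightarrow> wiener ?G (color_class ?G f' i) = real (max_wiener n (c i))"
    using exists_coloring_attaining_max_wiener[of c k n] by blast
  have "i \<in> f' ` {..<n}" if i: "i \<in> {1..k}" for i
  proof -
    have "i \<in> f ` {..<n}" using surj i by simp
    then have "color_class ?G f i \<noteq> {}" by (auto simp: color_class_def)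
    moreover have "finite (color_class ?G f i)" by (simp add: color_class_def)
    ultimately have "card (color_class ?G f' i) \<noteq> 0"
      using attained(1)[OF i] by (simp add: c_def)
    then have "color_class ?G f' i \<noteq> {}" by auto
    then show ?thesis by (auto simp: color_class_def)
  qed
  then have "surj_coloring ?G k f'"
    using f' by (auto simp: surj_coloring_def)
  moreover have "map (\<lambda>i. card (color_class ?G f' i)) [1..<Suc k] = map c [1..<Suc k]"
    using attained(1) by (intro map_cong) auto
  then have "coloring_type ?G k f' = coloring_type ?G k f"
    by (simp only: coloring_type_def c_def)
  ultimately have "coloring_wiener ?G k f' \<le> coloring_wiener ?G k f"
    using assms by (simp add: weak_maximizer_def)
  moreover have "coloring_wiener ?G k f' = (\<Sum>i=1..k. real (max_wiener n (c i)))"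
    unfolding coloring_wiener_def using attained(2) by (intro sum.cong) auto
  moreover have "coloring_wiener ?G k f \<le> (\<Sum>i=1..k. real (max_wiener n (c i)))"
    unfolding coloring_wiener_def c_def
    by (intro sum_mono wiener_cycle_graph_le) (auto simp: color_class_def)
  ultimately have "coloring_wiener ?G k f = real (\<Sum>i=1..k. max_wiener n (c i))"
    by simp
  also have "(\<Sum>i=1..k. max_wiener n (c i)) = (\<Sum>i\<leftarrow>[1..<Suc k]. max_wiener n (c i))"
    by (simp only: interv_sum_list_conv_sum_set_nat atLeastLessThanSuc_atLeastAtMost set_upt)
  also have "\<dots> = (\<Sum>m\<leftarrow>sort (map c [1..<Suc k]). max_wiener n m)"
    by (simp add: multiset.map_comp o_def del: upt_Suc flip: sum_mset_sum_list)
  also have "sort (map c [1..<Suc k]) = coloring_type ?G k f"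
    by (simp only: coloring_type_def c_def)
  finally show ?thesis .
qed

lemma coloring_type_le_card_verts:
  assumes "finite (verts G)" "m \<in> set (coloring_type G k f)"
  shows "m \<le> card (verts G)"
proof -
  obtain i where "m = card (color_class G f i)"
    using assms(2) by (auto simp: coloring_type_def simp del: upt_Suc)
  then show ?thesis
    using assms(1) by (auto simp: color_class_def intro: card_mono)
qed

theorem corollary4p10:
  fixes n k :: nat and f g :: "nat \<Rightarrow> nat"
  assumes "n \<ge> 1" and "k \<ge> 2"
    and "weak_maximizer (cycle_graph n) k f"
    and "weak_maximizer (cycle_graph n) k g"
    and "majorized (map real (coloring_type (cycle_graph n) k g))
                   (map real (coloring_type (cycle_graph n) k f))"
  shows "coloring_wiener (cycle_graph n) k g \<le> coloring_wiener (cycle_graph n) k f"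
proof -
  have sizes: "set (coloring_type (cycle_graph n) k h) \<subseteq> {..n}" for h
    using coloring_type_le_card_verts[of "cycle_graph n"] by auto
  have "(\<Sum>m\<leftarrow>coloring_type (cycle_graph n) k g. max_wiener n m) \<le>
        (\<Sum>m\<leftarrow>coloring_type (cycle_graph n) k f. max_wiener n m)"
    unfolding max_wiener_def
    by (rule sum_list_le_if_majorized[OF assms(5) mono_on_gain sizes sizes])
  then show ?thesis
    unfolding coloring_wiener_weak_maximizer[OF assms(3)] coloring_wiener_weak_maximizer[OF assms(4)]
    by (simp only: of_nat_le_iff)
qed

end
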